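(* Let $G=(V,E)$ be a locally finite, connected graph satisfying $CDE'(n,K)$ with $n>0$ and $K>0$. Then the diameter $\widetilde D=\sup_{x,y\in V}\widetilde d(x,y)$ of $G$ in terms of the canonical distance $\widetilde d$ satisfies $$\widetilde D\le 4\sqrt3\,\pi\sqrt{\frac nK},$$ and in particular is finite. Furthermore the diameter $D=\sup_{x,y\in V}d(x,y)$ of $G$ in terms of the graph distance $d$ is also finite, and satisfies $$D\le 2\pi\sqrt{\frac{6D_\mu n}{K}}.$$
   Context: $G=(V,E)$ is a finite or infinite connected graph with symmetric edge weights $\omega:V\times V\to[0,\infty)$, $\omega_{xy}=\omega_{yx}$, where $x\sim y$ iff $\omega_{xy}>0$. Standing assumptions: $\omega_{\min}=\inf\{\omega_{xy}:\omega_{xy}>0\}>0$; $m(x):=\sum_{y\sim x}\omega_{xy}<\infty$ for all $x$; $\mu:V\to(0,\infty)$ is a measure with $D_\mu:=\sup_{x}m(x)/\mu(x)<\infty$. The Laplacian is $\Delta f(x)=\frac1{\mu(x)}\sum_{y\sim x}\omega_{xy}(f(y)-f(x))$; $d$ is the graph distance (least number of edges of a path). $2\Gamma(f,g)=\Delta(fg)-f\Delta g-g\Delta f$, $\Gamma(f)=\Gamma(f,f)$; $2\Gamma_2(f,g)=\Delta\Gamma(f,g)-\Gamma(f,\Delta g)-\Gamma(\Delta f,g)$, $\Gamma_2(f)=\Gamma_2(f,f)$; for $f>0$, $\widetilde\Gamma_2(f)=\Gamma_2(f)-\Gamma\left(f,\frac{\Gamma(f)}f\right)$. $G$ satisfies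 $CDE'(n,K)$ if for every $f:V\to(0,\infty)$ and every $x\in V$, $\widetilde\Gamma_2(f)(x)\ge\frac1n f(x)^2(\Delta\log f)(x)^2+K\,\Gamma(f)(x)$. Canonical distance: $\widetilde d(x,y)=\sup\{|f(x)-f(y)|: f:V\to\mathbb R\text{ bounded},\ \|\Gamma(f)\|_\infty\le1\}$. *)

theory Defs
  imports "HOL-Analysis.Analysis"
begin

text \<open>The vertex set is the whole of the type \<open>'a\<close>, finite or infinite. Edges are encoded by the
  weight alone: \<open>x \<sim> y\<close> iff \<open>0 < \<omega> x y\<close>. Loops are not excluded.\<close>

definition adj :: "('a \<Rightarrow> 'a \<Rightarrow> real) \<Rightarrow> 'a rel" where
  "adj \<omega> = {(x, y). 0 < \<omega> x y}"

definition nbrs :: "('a \<Rightarrow> 'a \<Rightarrow> real) \<Rightarrow> 'a \<Rightarrow> 'a set" where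
  "nbrs \<omega> x = {y. 0 < \<omega> x y}"

definition vertex_weight :: "('a \<Rightarrow> 'a \<Rightarrow> real) \<Rightarrow> 'a \<Rightarrow> real" where
  "vertex_weight \<omega> x = (\<Sum>y\<in>nbrs \<omega> x. \<omega> x y)"

definition omega_min :: "('a \<Rightarrow> 'a \<Rightarrow> real) \<Rightarrow> ereal" where
  "omega_min \<omega> = Inf {ereal (\<omega> x y) | x y. 0 < \<omega> x y}"

definition sup_norm :: "('a \<Rightarrow> real) \<Rightarrow> ereal" where
  "sup_norm f = (SUP x. ereal \<bar>f x\<bar>)"

text \<open>Local finiteness makes all sums over neighbours finite; in particular it subsumes the
  requirement \<open>m(x) < \<infinity>\<close>, where \<open>m(x)\<close> is \<^const>\<open>vertex_weight\<close>.\<close>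

locale weighted_graph =
  fixes \<omega> :: "'a \<Rightarrow> 'a \<Rightarrow> real" and \<mu> :: "'a \<Rightarrow> real"
  assumes weight_nonneg: "\<And>x y. 0 \<le> \<omega> x y"
    and weight_sym: "\<And>x y. \<omega> x y = \<omega> y x"
    and locally_finite: "\<And>x. finite (nbrs \<omega> x)"
    and connected: "\<And>x y. (x, y) \<in> (adj \<omega>)\<^sup>*"
    and omega_min_pos: "0 < omega_min \<omega>"
    and measure_pos: "\<And>x. 0 < \<mu> x"
    and D_mu_finite: "bdd_above (range (\<lambda>x. vertex_weight \<omega> x / \<mu> x))"
begin

definition D_mu :: real where
  "D_mu = (SUP x. vertex_weight \<omega> x / \<mu> x)"

definition laplacian :: "('a \<Rightarrow> real) \<Rightarrow> 'a \<Rightarrow> real" where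
  "laplacian f x = (1 / \<mu> x) * (\<Sum>y\<in>nbrs \<omega> x. \<omega> x y * (f y - f x))"

definition Gamma :: "('a \<Rightarrow> real) \<Rightarrow> ('a \<Rightarrow> real) \<Rightarrow> 'a \<Rightarrow> real" where
  "Gamma f g x =
     (laplacian (\<lambda>y. f y * g y) x - f x * laplacian g x - g x * laplacian f x) / 2"

definition Gamma2 :: "('a \<Rightarrow> real) \<Rightarrow> ('a \<Rightarrow> real) \<Rightarrow> 'a \<Rightarrow> real" where
  "Gamma2 f g x =
     (laplacian (Gamma f g) x - Gamma f (laplacian g) x - Gamma (laplacian f) g x) / 2"

definition Gamma2_tilde :: "('a \<Rightarrow> real) \<Rightarrow> 'a \<Rightarrow> real" where
  "Gamma2_tilde f x = Gamma2 f f x - Gamma f (\<lambda>y. Gamma f f y / f y) x"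

definition CDE' :: "real \<Rightarrow> real \<Rightarrow> bool" where
  "CDE' n K \<longleftrightarrow> (\<forall>f. (\<forall>y. 0 < f y) \<longrightarrow> (\<forall>x.
     Gamma2_tilde f x
       \<ge> (1 / n) * (f x)\<^sup>2 * (laplacian (\<lambda>y. ln (f y)) x)\<^sup>2 + K * Gamma f f x))"

definition canonical_dist :: "'a \<Rightarrow> 'a \<Rightarrow> ereal" where
  "canonical_dist x y =
     Sup {ereal \<bar>f x - f y\<bar> | f. bounded (range f) \<and> sup_norm (Gamma f f) \<le> 1}"

definition canonical_diam :: ereal where
  "canonical_diam = (SUP x. SUP y. canonical_dist x y)"

text \<open>The relation power \<open>adj \<omega> ^^ k\<close> relates the endpoints of walks with \<open>k\<close> edges; a shortest
  walk is a path.\<close>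

definition graph_dist :: "'a \<Rightarrow> 'a \<Rightarrow> nat" where
  "graph_dist x y = (LEAST k. (x, y) \<in> adj \<omega> ^^ k)"

definition graph_diam :: ereal where
  "graph_diam = (SUP x. SUP y. ereal (real (graph_dist x y)))"

end

end

theory Submission
  imports Defs
begin

text \<open>Linearizing \<open>CDE'(n, K)\<close> at constant functions gives
  \<open>\<Gamma>\<^sub>2(g) \<ge> (\<Delta>g)\<^sup>2 / n + K \<Gamma>(g)\<close>. For the averaging operator
  \<open>Q = 1 + \<epsilon>\<Delta>\<close> with a fixed small \<open>\<epsilon>\<close> this controls \<open>\<Gamma>(Qg)\<close>: if \<open>\<Gamma>(g) \<le> M\<close>, then
  \<open>\<Gamma>(Q\<^sup>T g) \<le> (1 - \<epsilon>K)\<^sup>T M\<close> and \<open>(\<Delta>Q\<^sup>T g)\<^sup>2 \<le> n M / (\<epsilon>(T + 1))\<close>. Take \<open>N\<close> with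
  \<open>2 \<le> \<epsilon>KN \<le> 3\<close>: applying \<open>Q\<^sup>N\<close> moves \<open>g\<close> by at most \<open>2 \<surd>(3nM/K)\<close> and divides the bound
  \<open>M\<close> by 4. Iterating, \<open>f\<close> is within \<open>4 \<surd>(3nM/K)\<close> of functions whose differences tend to 0, so its
  oscillation is at most \<open>8 \<surd>(3nM/K)\<close>. Take \<open>M = 1\<close> for the canonical distance; the function
  \<open>d(x, \<cdot>)\<close> has \<open>\<Gamma> \<le> D\<^sub>\<mu> / 2\<close>, which gives the graph distance. The stated constants follow from
  \<open>2 \<le> \<pi>\<close>.\<close>

context weighted_graph
begin

section \<open>Algebra of the Laplacian, \<open>Gamma\<close> and \<open>Gamma2\<close>\<close>

lemma laplacian_add: "laplacian (\<lambda>y. f y + g y) x = laplacian f x + laplacian g x"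
  by (simp add: laplacian_def algebra_simps sum.distrib sum_subtractf)

lemma laplacian_scale: "laplacian (\<lambda>y. c * f y) x = c * laplacian f x"
  by (simp add: laplacian_def algebra_simps sum_distrib_left sum_subtractf)

lemma laplacian_const: "laplacian (\<lambda>y. c) x = 0"
  by (simp add: laplacian_def)

lemma laplacian_sum_form: "laplacian f x = (\<Sum>y\<in>nbrs \<omega> x. \<omega> x y * (f y - f x)) / \<mu> x"
  by (simp add: laplacian_def)

text \<open>This form makes symmetry, bilinearity and positivity of \<open>Gamma\<close> visible;
  most estimates start from it.\<close>

lemma Gamma_sum_form:
  "Gamma f g x = (\<Sum>y\<in>nbrs \<omega> x. \<omega> x y * ((f y - f x) * (g y - g x))) / (2 * \<mu> x)"
proof -
  have "(\<Sum>y\<in>nbrs \<omega> x. \<omega> x y * (f y * g y - f x * g x))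
      - f x * (\<Sum>y\<in>nbrs \<omega> x. \<omega> x y * (g y - g x)) - g x * (\<Sum>y\<in>nbrs \<omega> x. \<omega> x y * (f y - f x))
     = (\<Sum>y\<in>nbrs \<omega> x. \<omega> x y * ((f y - f x) * (g y - g x)))"
    by (simp add: sum_distrib_left flip: sum_subtractf) (simp add: algebra_simps)
  then show ?thesis
    using measure_pos[of x] by (simp add: Gamma_def laplacian_sum_form field_simps)
qed

lemma Gamma_nonneg: "0 \<le> Gamma f f x"
  using measure_pos[of x] weight_nonneg
  by (simp add: Gamma_sum_form sum_nonneg)

lemma Gamma_commute: "Gamma f g x = Gamma g f x"
  by (simp add: Gamma_sum_form mult.commute)

lemma Gamma_affine_left: "Gamma (\<lambda>y. a + c * f y) g x = c * Gamma f g x"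
  by (simp add: Gamma_sum_form sum_distrib_left algebra_simps flip: sum_subtractf)

lemma Gamma_affine_right: "Gamma f (\<lambda>y. a + c * g y) x = c * Gamma f g x"
  using Gamma_affine_left[of a c g f x] by (simp add: Gamma_commute)

lemma Gamma_add_scale:
  "Gamma (\<lambda>y. f y + c * g y) (\<lambda>y. f y + c * g y) x
    = Gamma f f x + 2 * c * Gamma f g x + c\<^sup>2 * Gamma g g x"
proof -
  have "(\<Sum>y\<in>nbrs \<omega> x. \<omega> x y * (((f y + c * g y) - (f x + c * g x)) * ((f y + c * g y) - (f x + c * g x))))
    = (\<Sum>y\<in>nbrs \<omega> x. \<omega> x y * ((f y - f x) * (f y - f x)))
      + 2 * c * (\<Sum>y\<in>nbrs \<omega> x. \<omega> x y * ((f y - f x) * (g y - g x)))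
      + c\<^sup>2 * (\<Sum>y\<in>nbrs \<omega> x. \<omega> x y * ((g y - g x) * (g y - g x)))"
    by (simp add: sum_distrib_left flip: sum.distrib) (simp add: algebra_simps power2_eq_square)
  then show ?thesis
    by (simp add: Gamma_sum_form add_divide_distrib)
qed

text \<open>Lets \<open>exp (t * g)\<close>, written as \<open>1 + t * h t\<close>, be replaced by
  its difference quotient \<open>h t\<close>.\<close>

lemma Gamma2_affine: "Gamma2 (\<lambda>y. a + c * f y) (\<lambda>y. a + c * f y) x = c\<^sup>2 * Gamma2 f f x"
proof -
  have G: "Gamma (\<lambda>y. a + c * f y) (\<lambda>y. a + c * f y) = (\<lambda>y. c\<^sup>2 * Gamma f f y)"
    by (simp add: Gamma_affine_left Gamma_affine_right power2_eq_square fun_eq_iff)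
  have L: "laplacian (\<lambda>y. a + c * f y) = (\<lambda>y. 0 + c * laplacian f y)"
    by (simp add: laplacian_add laplacian_scale laplacian_const fun_eq_iff)
  show ?thesis
    unfolding Gamma2_def G L Gamma_affine_left Gamma_affine_right laplacian_scale
    by (simp add: power2_eq_square algebra_simps)
qed

section \<open>Linearization of the curvature condition at constants\<close>

text \<open>Each value is a finite sum over neighbours, so pointwise convergence suffices.\<close>

lemma tendsto_laplacian:
  assumes "\<And>y. ((\<lambda>t. F t y) \<longlongrightarrow> f y) A"
  shows "((\<lambda>t. laplacian (F t) x) \<longlongrightarrow> laplacian f x) A"
  unfolding laplacian_def by (intro tendsto_intros assms)

lemma tendsto_Gamma:
  assumes "\<And>y. ((\<lambda>t. F t y) \<longlongrightarrow> f y) A" and "\<And>y. ((\<lambda>t. G t y) \<longlongrightarrow> g y) A"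
  shows "((\<lambda>t. Gamma (F t) (G t) x) \<longlongrightarrow> Gamma f g x) A"
  unfolding Gamma_def by (intro tendsto_intros tendsto_laplacian assms) auto

lemma tendsto_Gamma2:
  assumes "\<And>y. ((\<lambda>t. F t y) \<longlongrightarrow> f y) A"
  shows "((\<lambda>t. Gamma2 (F t) (F t) x) \<longlongrightarrow> Gamma2 f f x) A"
  unfolding Gamma2_def by (intro tendsto_intros tendsto_laplacian tendsto_Gamma assms) auto

text \<open>The classical \<open>CD(n, K)\<close> inequality: the second-order term at \<open>t = 0\<close> of \<open>CDE'(n, K)\<close>
  applied to \<open>exp (t * g)\<close>.\<close>

lemma CDE'_imp_CD:
  assumes "CDE' n K"
  shows "(1 / n) * (laplacian g x)\<^sup>2 + K * Gamma g g x \<le> Gamma2 g g x"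
proof -
  \<comment> \<open>Difference quotient of \<open>exp (t * g)\<close> at \<open>t = 0\<close>; it
    tends to \<open>g\<close>.\<close>
  define h where "h t y = (exp (t * g y) - 1) / t" for t y
  have h: "((\<lambda>t. h t y) \<longlongrightarrow> g y) (at_right 0)" for y
  proof -
    have "((\<lambda>t. exp (t * g y)) has_real_derivative g y) (at 0)"
      by (auto intro!: derivative_eq_intros)
    then have "((\<lambda>t. (exp (t * g y) - 1) / t) \<longlongrightarrow> g y) (at 0)"
      by (simp add: DERIV_def)
    then show ?thesis
      unfolding h_def by (rule filterlim_mono) (auto simp: at_le)
  qed
  have e: "((\<lambda>t. exp (t * g y)) \<longlongrightarrow> 1) (at_right 0)" for y
    by (auto intro!: tendsto_eq_intros)
  have ineq: "(1 / n) * (exp (t * g x))\<^sup>2 * (laplacian g x)\<^sup>2 + K * Gamma (h t) (h t) x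
      \<le> Gamma2 (h t) (h t) x - t * Gamma (h t) (\<lambda>y. Gamma (h t) (h t) y / exp (t * g y)) x"
    if "t > 0" for t
  proof -
    define f where "f y = exp (t * g y)" for y
    have f: "f = (\<lambda>y. 1 + t * h t y)"
      using that by (auto simp: f_def h_def)
    have G: "Gamma f f y = t\<^sup>2 * Gamma (h t) (h t) y" for y
      by (simp add: f Gamma_affine_left Gamma_affine_right power2_eq_square)
    have G2: "Gamma2 f f y = t\<^sup>2 * Gamma2 (h t) (h t) y" for y
      by (simp add: f Gamma2_affine)
    \<comment> \<open>This correction is of third order in \<open>t\<close>: after division by
      \<open>t\<^sup>2\<close> a factor \<open>t\<close> remains, so it vanishes in the
      limit.\<close>
    have "Gamma f (\<lambda>y. Gamma f f y / f y) x
        = Gamma (\<lambda>y. 1 + t * h t y) (\<lambda>y. 0 + t\<^sup>2 * (Gamma (h t) (h t) y / f y)) x"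
      by (simp add: G) (simp add: f)
    also have "\<dots> = t\<^sup>2 * (t * Gamma (h t) (\<lambda>y. Gamma (h t) (h t) y / f y) x)"
      by (simp only: Gamma_affine_left Gamma_affine_right) simp
    finally have G3: "Gamma f (\<lambda>y. Gamma f f y / f y) x
        = t\<^sup>2 * (t * Gamma (h t) (\<lambda>y. Gamma (h t) (h t) y / f y) x)" .
    \<comment> \<open>The choice of an exponential makes the logarithm exactly linear in
      \<open>t\<close>.\<close>
    have L: "laplacian (\<lambda>y. ln (f y)) x = t * laplacian g x"
      by (simp add: f_def laplacian_scale)
    have "(1 / n) * (f x)\<^sup>2 * (laplacian (\<lambda>y. ln (f y)) x)\<^sup>2 + K * Gamma f f x \<le> Gamma2_tilde f x"
      using assms[unfolded CDE'_def, rule_format, of f x] by (simp add: f_def)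
    then have "t\<^sup>2 * ((1 / n) * (f x)\<^sup>2 * (laplacian g x)\<^sup>2 + K * Gamma (h t) (h t) x)
      \<le> t\<^sup>2 * (Gamma2 (h t) (h t) x - t * Gamma (h t) (\<lambda>y. Gamma (h t) (h t) y / f y) x)"
      unfolding Gamma2_tilde_def G3 G2 L unfolding G by (simp add: algebra_simps power_mult_distrib)
    then show ?thesis
      using that by (simp add: f_def)
  qed
  have "((\<lambda>t. (1 / n) * (exp (t * g x))\<^sup>2 * (laplacian g x)\<^sup>2 + K * Gamma (h t) (h t) x)
      \<longlongrightarrow> (1 / n) * 1\<^sup>2 * (laplacian g x)\<^sup>2 + K * Gamma g g x) (at_right 0)"
    by (intro tendsto_intros tendsto_Gamma h e)
  moreover have "((\<lambda>t. Gamma2 (h t) (h t) x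
        - t * Gamma (h t) (\<lambda>y. Gamma (h t) (h t) y / exp (t * g y)) x)
      \<longlongrightarrow> Gamma2 g g x - 0 * Gamma g (\<lambda>y. Gamma g g y / 1) x) (at_right 0)"
    by (intro tendsto_intros tendsto_Gamma tendsto_Gamma2 h e) auto
  moreover have "eventually (\<lambda>t. (1 / n) * (exp (t * g x))\<^sup>2 * (laplacian g x)\<^sup>2 + K * Gamma (h t) (h t) x
      \<le> Gamma2 (h t) (h t) x - t * Gamma (h t) (\<lambda>y. Gamma (h t) (h t) y / exp (t * g y)) x)
     (at_right (0::real))"
    using ineq by (auto simp: eventually_at_right_less intro: eventually_mono[OF eventually_at_right_less])
  ultimately have "(1 / n) * 1\<^sup>2 * (laplacian g x)\<^sup>2 + K * Gamma g g x
      \<le> Gamma2 g g x - 0 * Gamma g (\<lambda>y. Gamma g g y / 1) x"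
    by (intro tendsto_le[OF trivial_limit_at_right_real])
  then show ?thesis by simp
qed

section \<open>Bounds in terms of \<open>D_mu\<close>\<close>

lemma vertex_weight_le_D_mu: "vertex_weight \<omega> x \<le> D_mu * \<mu> x"
proof -
  have "vertex_weight \<omega> x / \<mu> x \<le> D_mu"
    unfolding D_mu_def by (rule cSUP_upper[OF _ D_mu_finite]) simp
  then show ?thesis using measure_pos[of x] by (simp add: field_simps)
qed

lemma vertex_weight_nonneg: "0 \<le> vertex_weight \<omega> x"
  using weight_nonneg by (simp add: vertex_weight_def sum_nonneg)

lemma D_mu_nonneg: "0 \<le> D_mu"
  \<comment> \<open>\<open>undefined\<close> serves as an arbitrary vertex.\<close>
  using vertex_weight_le_D_mu[of undefined] vertex_weight_nonneg[of undefined] measure_pos[of undefined]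
  by (smt (verit) mult_neg_pos)

text \<open>Cauchy-Schwarz with each weight split into two square roots; one factor sums to m(x),
  the other is a multiple of \<open>Gamma g g x\<close>.\<close>

lemma laplacian_square_le: "(laplacian g x)\<^sup>2 \<le> 2 * D_mu * Gamma g g x"
proof -
  let ?N = "nbrs \<omega> x"
  let ?S = "\<Sum>y\<in>?N. \<omega> x y * (g y - g x)\<^sup>2"
  have "(\<Sum>y\<in>?N. sqrt (\<omega> x y) * (sqrt (\<omega> x y) * (g y - g x)))\<^sup>2
     \<le> (\<Sum>y\<in>?N. (sqrt (\<omega> x y))\<^sup>2) * (\<Sum>y\<in>?N. (sqrt (\<omega> x y) * (g y - g x))\<^sup>2)"
    by (rule Cauchy_Schwarz_ineq_sum)
  then have cs: "(\<Sum>y\<in>?N. \<omega> x y * (g y - g x))\<^sup>2 \<le> vertex_weight \<omega> x * ?S"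
    using weight_nonneg by (simp add: power_mult_distrib vertex_weight_def flip: mult.assoc)
  have S: "0 \<le> ?S" using weight_nonneg by (simp add: sum_nonneg)
  have "(laplacian g x)\<^sup>2 = (\<Sum>y\<in>?N. \<omega> x y * (g y - g x))\<^sup>2 / (\<mu> x)\<^sup>2"
    by (simp add: laplacian_sum_form power_divide)
  also have "\<dots> \<le> (D_mu * \<mu> x * ?S) / (\<mu> x)\<^sup>2"
    by (intro divide_right_mono order_trans[OF cs] mult_right_mono vertex_weight_le_D_mu S) auto
  also have "\<dots> = 2 * D_mu * Gamma g g x"
    using measure_pos[of x] by (simp add: Gamma_sum_form power2_eq_square)
  finally show ?thesis .
qed

lemma Gamma_le_of_edge_bound:
  assumes "0 \<le> B" and "\<And>y. 0 < \<omega> x y \<Longrightarrow> (h y - h x)\<^sup>2 \<le> B"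
  shows "Gamma h h x \<le> D_mu * B / 2"
proof -
  have "(\<Sum>y\<in>nbrs \<omega> x. \<omega> x y * ((h y - h x) * (h y - h x))) \<le> (\<Sum>y\<in>nbrs \<omega> x. \<omega> x y * B)"
    using assms by (intro sum_mono mult_left_mono) (auto simp: nbrs_def power2_eq_square)
  also have "\<dots> = vertex_weight \<omega> x * B"
    by (simp add: vertex_weight_def sum_distrib_right)
  also have "\<dots> \<le> D_mu * \<mu> x * B"
    by (intro mult_right_mono vertex_weight_le_D_mu assms)
  finally show ?thesis
    using measure_pos[of x] by (simp add: Gamma_sum_form field_simps)
qed

text \<open>Controls the second-order term of one Euler step.\<close>

lemma Gamma_laplacian_le:
  assumes "\<And>y. Gamma g g y \<le> M"
  shows "Gamma (laplacian g) (laplacian g) x \<le> 4 * D_mu\<^sup>2 * M"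
proof -
  have M: "0 \<le> M" using assms[of x] Gamma_nonneg[of g x] by linarith
  have L: "(laplacian g y)\<^sup>2 \<le> 2 * D_mu * M" for y
    using order_trans[OF laplacian_square_le mult_left_mono[OF assms]] D_mu_nonneg by simp
  have "(laplacian g y - laplacian g x)\<^sup>2 \<le> 8 * D_mu * M" for y
  proof -
    \<comment> \<open>Parallelogram identity: each of the two squares on the right is at most
      \<open>2 * D_mu * M\<close>.\<close>
    have "(laplacian g y - laplacian g x)\<^sup>2 + (laplacian g y + laplacian g x)\<^sup>2
        = 2 * (laplacian g y)\<^sup>2 + 2 * (laplacian g x)\<^sup>2"
      by (simp add: power2_eq_square algebra_simps)
    then show ?thesis using L[of x] L[of y] zero_le_power2[of "laplacian g y + laplacian g x"]
      by linarith
  qed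
  then have "Gamma (laplacian g) (laplacian g) x \<le> D_mu * (8 * D_mu * M) / 2"
    using D_mu_nonneg M by (intro Gamma_le_of_edge_bound) auto
  then show ?thesis by (simp add: power2_eq_square mult_ac)
qed

section \<open>The averaging step\<close>

text \<open>One step of the lazy random walk, which is also one explicit Euler step of the heat flow. It
  replaces the heat semigroup, so that only finite sums occur.\<close>

definition walk_step :: "real \<Rightarrow> ('a \<Rightarrow> real) \<Rightarrow> 'a \<Rightarrow> real" where
  "walk_step \<epsilon> f x = f x + \<epsilon> * laplacian f x"

text \<open>The coefficients sum to 1 and are nonnegative if 0 \<le> \<epsilon> and
  \<open>\<epsilon> * D_mu \<le> 1\<close>.\<close>

lemma walk_step_averaging:
  "walk_step \<epsilon> f x = (1 - \<epsilon> * vertex_weight \<omega> x / \<mu> x) * f x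
     + (\<Sum>y\<in>nbrs \<omega> x. \<epsilon> * \<omega> x y / \<mu> x * f y)"
proof -
  have L: "laplacian f x
      = ((\<Sum>y\<in>nbrs \<omega> x. \<omega> x y * f y) - vertex_weight \<omega> x * f x) / \<mu> x"
    by (simp add: laplacian_sum_form vertex_weight_def right_diff_distrib sum_subtractf sum_distrib_right)
  have "(\<Sum>y\<in>nbrs \<omega> x. \<epsilon> * \<omega> x y / \<mu> x * f y)
      = \<epsilon> * (\<Sum>y\<in>nbrs \<omega> x. \<omega> x y * f y) / \<mu> x"
    by (simp add: sum_distrib_left sum_divide_distrib mult.assoc)
  then show ?thesis
    by (simp add: walk_step_def L left_diff_distrib right_diff_distrib diff_divide_distrib)
qed

text \<open>Subtracting \<open>\<delta> * f x\<close> lowers the holding coefficient at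
  \<open>x\<close> by \<open>\<delta>\<close>, and it stays nonnegative. Taking
  \<open>\<delta> = 2 * \<epsilon> * K\<close> later turns the curvature term into a
  contraction.\<close>

lemma walk_step_mono:
  assumes "0 \<le> \<epsilon>" and "\<epsilon> * D_mu + \<delta> \<le> 1" and "\<And>y. f y \<le> g y"
  shows "walk_step \<epsilon> f x - \<delta> * f x \<le> walk_step \<epsilon> g x - \<delta> * g x"
proof -
  have "\<epsilon> * (vertex_weight \<omega> x / \<mu> x) \<le> \<epsilon> * D_mu"
    using vertex_weight_le_D_mu[of x] measure_pos[of x] assms(1)
    by (intro mult_left_mono) (simp_all add: field_simps)
  then have "(1 - \<epsilon> * vertex_weight \<omega> x / \<mu> x - \<delta>) * f x \<le> (1 - \<epsilon> * vertex_weight \<omega> x / \<mu> x - \<delta>) * g x"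
    using assms by (intro mult_left_mono) auto
  moreover have "(\<Sum>y\<in>nbrs \<omega> x. \<epsilon> * \<omega> x y / \<mu> x * f y) \<le> (\<Sum>y\<in>nbrs \<omega> x. \<epsilon> * \<omega> x y / \<mu> x * g y)"
    using assms weight_nonneg less_imp_le[OF measure_pos]
    by (intro sum_mono mult_left_mono) auto
  ultimately show ?thesis
    unfolding walk_step_averaging by (simp add: algebra_simps)
qed

lemma walk_step_const: "walk_step \<epsilon> (\<lambda>y. c) x = c"
  by (simp add: walk_step_def laplacian_const)

lemma walk_step_Jensen:
  assumes "0 \<le> \<epsilon>" and "\<epsilon> * D_mu \<le> 1"
  shows "(walk_step \<epsilon> f x)\<^sup>2 \<le> walk_step \<epsilon> (\<lambda>y. (f y)\<^sup>2) x"
proof -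
  define a where "a = walk_step \<epsilon> f x"
  have "walk_step \<epsilon> (\<lambda>y. 2 * a * f y + - a\<^sup>2) x - 0 * (2 * a * f x + - a\<^sup>2)
      \<le> walk_step \<epsilon> (\<lambda>y. (f y)\<^sup>2) x - 0 * (f x)\<^sup>2"
  proof (rule walk_step_mono)
    \<comment> \<open>Tangent line of the square at \<open>a\<close>; the step acts exactly on
      affine images of \<open>f\<close>.\<close>
    show "2 * a * f y + - a\<^sup>2 \<le> (f y)\<^sup>2" for y
      using zero_le_power2[of "f y - a"] by (simp add: power2_eq_square algebra_simps)
  qed (use assms in auto)
  moreover have "walk_step \<epsilon> (\<lambda>y. 2 * a * f y + - a\<^sup>2) x = 2 * a * walk_step \<epsilon> f x - a\<^sup>2"
    unfolding walk_step_def laplacian_add laplacian_scale laplacian_const by (simp add: algebra_simps)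
  ultimately show ?thesis
    by (simp add: a_def power2_eq_square)
qed

lemma laplacian_walk_step: "laplacian (walk_step \<epsilon> f) x = walk_step \<epsilon> (laplacian f) x"
  using laplacian_add[of f "\<lambda>y. \<epsilon> * laplacian f y" x]
  by (simp add: laplacian_scale walk_step_def[abs_def])

text \<open>In the expansion of the quadratic form, the definition of \<open>Gamma2\<close> rewrites
  the cross term \<open>2 * \<epsilon> * Gamma g (laplacian g) x\<close>.\<close>

lemma Gamma_walk_step:
  "Gamma (walk_step \<epsilon> g) (walk_step \<epsilon> g) x
    = walk_step \<epsilon> (Gamma g g) x - 2 * \<epsilon> * Gamma2 g g x + \<epsilon>\<^sup>2 * Gamma (laplacian g) (laplacian g) x"
  unfolding Gamma2_def walk_step_def[abs_def] Gamma_add_scale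
  by (simp add: Gamma_commute[of "laplacian g" g] field_simps)

text \<open>Adds edge bounds along a path from \<open>x\<close> to \<open>y\<close>.
  \<open>C\<close> depends on the endpoints but not on \<open>h\<close> and \<open>M\<close>, so
  differences vanish as \<open>M\<close> tends to 0.\<close>

lemma abs_diff_le_sqrt_Gamma:
  "\<exists>C. \<forall>h M. (\<forall>z. Gamma h h z \<le> M) \<longrightarrow> \<bar>h x - h y\<bar> \<le> C * sqrt M"
  using connected[of x y]
proof (induction rule: rtrancl_induct)
  case base
  then show ?case by (intro exI[of _ 0]) auto
next
  case (step y z)
  from step.IH obtain C where C: "\<And>h M. (\<forall>z. Gamma h h z \<le> M) \<Longrightarrow> \<bar>h x - h y\<bar> \<le> C * sqrt M"
    by blast
  from step.hyps have w: "0 < \<omega> y z" by (simp add: adj_def)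
  have "\<bar>h x - h z\<bar> \<le> (C + sqrt (2 * \<mu> y / \<omega> y z)) * sqrt M" if M: "\<forall>z. Gamma h h z \<le> M" for h M
  proof -
    \<comment> \<open>A single edge contributes at most the whole sum in
      \<open>Gamma h h y\<close>.\<close>
    have "\<omega> y z * ((h z - h y) * (h z - h y)) \<le> (\<Sum>u\<in>nbrs \<omega> y. \<omega> y u * ((h u - h y) * (h u - h y)))"
      using w locally_finite[of y] weight_nonneg by (intro member_le_sum) (auto simp: nbrs_def)
    also have "\<dots> = 2 * \<mu> y * Gamma h h y"
      using measure_pos[of y] by (simp add: Gamma_sum_form)
    also have "\<dots> \<le> 2 * \<mu> y * M"
      using measure_pos[of y] M by (intro mult_left_mono) auto
    finally have "(h z - h y)\<^sup>2 \<le> 2 * \<mu> y / \<omega> y z * M"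
      using w by (simp add: field_simps power2_eq_square)
    then have "\<bar>h z - h y\<bar> \<le> sqrt (2 * \<mu> y / \<omega> y z) * sqrt M"
      using real_sqrt_le_mono by (fastforce simp: real_sqrt_mult[symmetric])
    with C[OF M] show ?thesis by (simp add: algebra_simps)
  qed
  then show ?case by blast
qed

end

section \<open>Decay of \<open>Gamma\<close> and of the Laplacian along the walk\<close>

text \<open>\<open>\<epsilon>_averaging\<close> leaves room for
  \<open>\<delta> = 2 * \<epsilon> * K\<close> in the holding coefficient;
  \<open>\<epsilon>_error\<close> keeps the quadratic Euler error below
  \<open>\<epsilon> * K * M\<close>, half of the largest curvature gain.\<close>

locale CD_walk = weighted_graph +
  fixes n K \<epsilon> :: real
  assumes n_pos: "0 < n" and K_pos: "0 < K" and \<epsilon>_pos: "0 < \<epsilon>"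
    and CD: "\<And>g x. (1 / n) * (laplacian g x)\<^sup>2 + K * Gamma g g x \<le> Gamma2 g g x"
    and \<epsilon>_averaging: "\<epsilon> * D_mu + 2 * \<epsilon> * K \<le> 1"
    and \<epsilon>_error: "\<epsilon> * (4 * D_mu\<^sup>2) \<le> K"
begin

abbreviation walk :: "nat \<Rightarrow> ('a \<Rightarrow> real) \<Rightarrow> 'a \<Rightarrow> real" where
  "walk T \<equiv> walk_step \<epsilon> ^^ T"

lemma \<epsilon>K: "0 < \<epsilon> * K" "\<epsilon> * K < 1" "\<epsilon> * D_mu \<le> 1"
proof -
  show *: "0 < \<epsilon> * K" using \<epsilon>_pos K_pos by simp
  have "0 \<le> \<epsilon> * D_mu" using \<epsilon>_pos D_mu_nonneg by simp
  with * \<epsilon>_averaging show "\<epsilon> * K < 1" "\<epsilon> * D_mu \<le> 1" by linarith+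
qed

lemma Gamma_walk_step_le:
  assumes "\<And>y. Gamma g g y \<le> M"
  shows "Gamma (walk_step \<epsilon> g) (walk_step \<epsilon> g) x
    \<le> walk_step \<epsilon> (Gamma g g) x - 2 * \<epsilon> * K * Gamma g g x - 2 * \<epsilon> / n * (laplacian g x)\<^sup>2 + \<epsilon> * K * M"
proof -
  have M: "0 \<le> M" using assms[of x] Gamma_nonneg[of g x] by linarith
  have "\<epsilon>\<^sup>2 * Gamma (laplacian g) (laplacian g) x \<le> \<epsilon>\<^sup>2 * (4 * D_mu\<^sup>2 * M)"
    by (intro mult_left_mono Gamma_laplacian_le assms) auto
  also have "\<dots> = \<epsilon> * ((\<epsilon> * (4 * D_mu\<^sup>2)) * M)"
    by (simp add: power2_eq_square)
  also have "\<dots> \<le> \<epsilon> * (K * M)"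
    using \<epsilon>_pos \<epsilon>_error M by (intro mult_left_mono mult_right_mono) auto
  finally have "\<epsilon>\<^sup>2 * Gamma (laplacian g) (laplacian g) x \<le> \<epsilon> * K * M" by simp
  moreover have "2 * \<epsilon> * ((1 / n) * (laplacian g x)\<^sup>2 + K * Gamma g g x) \<le> 2 * \<epsilon> * Gamma2 g g x"
    using \<epsilon>_pos by (intro mult_left_mono CD) auto
  ultimately show ?thesis
    unfolding Gamma_walk_step by (simp add: algebra_simps)
qed

text \<open>Monotonicity absorbs the curvature gain and yields
  \<open>1 - 2 * \<epsilon> * K\<close>; the Euler error gives back
  \<open>\<epsilon> * K\<close>.\<close>

lemma Gamma_walk_step_contract:
  assumes "\<And>y. Gamma g g y \<le> M"
  shows "Gamma (walk_step \<epsilon> g) (walk_step \<epsilon> g) x \<le> (1 - \<epsilon> * K) * M"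
proof -
  have "walk_step \<epsilon> (Gamma g g) x - 2 * \<epsilon> * K * Gamma g g x
      \<le> walk_step \<epsilon> (\<lambda>y. M) x - 2 * \<epsilon> * K * M"
    using \<epsilon>_pos \<epsilon>_averaging assms by (intro walk_step_mono) auto
  moreover have "0 \<le> 2 * \<epsilon> / n * (laplacian g x)\<^sup>2"
    using \<epsilon>_pos n_pos by simp
  ultimately show ?thesis
    using Gamma_walk_step_le[OF assms, of x] by (simp add: walk_step_const algebra_simps)
qed

lemma Gamma_walk_contract:
  assumes "\<And>y. Gamma g g y \<le> M"
  shows "Gamma (walk T g) (walk T g) x \<le> (1 - \<epsilon> * K) ^ T * M"
proof (induction T arbitrary: x)
  case 0
  then show ?case using assms by simp
next
  case (Suc T)
  then show ?case using Gamma_walk_step_contract[OF Suc.IH, of x] by (simp add: mult.assoc)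
qed

text \<open>The dimension term survives iteration because \<open>(laplacian (walk T g))\<^sup>2\<close> is moved past each
  further step by Jensen's inequality; the geometric series of the Euler errors sums to at most \<open>M\<close>.\<close>

lemma Gamma_walk_plus_laplacian:
  assumes "\<And>y. Gamma g g y \<le> M"
  shows "Gamma (walk (Suc T) g) (walk (Suc T) g) x
    \<le> M * (2 - (1 - \<epsilon> * K) ^ Suc T) - 2 * \<epsilon> / n * real (Suc T) * (laplacian (walk T g) x)\<^sup>2"
proof -
  let ?q = "1 - \<epsilon> * K"
  \<comment> \<open>One step from a bound with \<open>a\<close> accumulated dimension terms: the old
    ones are averaged, a new one appears. The Euler error is measured with the contracted bound
    \<open>?q ^ T * M\<close>.\<close>
  have step: "Gamma (walk (Suc T) g) (walk (Suc T) g) x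
    \<le> B - 2 * \<epsilon> / n * a * walk_step \<epsilon> (\<lambda>y. (h y)\<^sup>2) x
       - 2 * \<epsilon> / n * (laplacian (walk T g) x)\<^sup>2 + \<epsilon> * K * (?q ^ T * M)"
    if IH: "\<And>y. Gamma (walk T g) (walk T g) y \<le> B - 2 * \<epsilon> / n * a * (h y)\<^sup>2" for T B a h x
  proof -
    have "walk_step \<epsilon> (Gamma (walk T g) (walk T g)) x - 0 * Gamma (walk T g) (walk T g) x
        \<le> walk_step \<epsilon> (\<lambda>y. B + (- 2 * \<epsilon> / n * a) * (h y)\<^sup>2) x
          - 0 * (B + (- 2 * \<epsilon> / n * a) * (h x)\<^sup>2)"
      using \<epsilon>_pos \<epsilon>K IH by (intro walk_step_mono) auto
    also have "walk_step \<epsilon> (\<lambda>y. B + (- 2 * \<epsilon> / n * a) * (h y)\<^sup>2) x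
        = B - 2 * \<epsilon> / n * a * walk_step \<epsilon> (\<lambda>y. (h y)\<^sup>2) x"
      unfolding walk_step_def laplacian_add laplacian_scale laplacian_const by (simp add: algebra_simps)
    finally have "walk_step \<epsilon> (Gamma (walk T g) (walk T g)) x
        \<le> B - 2 * \<epsilon> / n * a * walk_step \<epsilon> (\<lambda>y. (h y)\<^sup>2) x"
      by simp
    \<comment> \<open>The curvature term is given away here; decay enters only through
      \<open>?q ^ T\<close>.\<close>
    moreover have "0 \<le> 2 * \<epsilon> * K * Gamma (walk T g) (walk T g) x"
      using \<epsilon>_pos K_pos Gamma_nonneg by simp
    ultimately show ?thesis
      using Gamma_walk_step_le[OF Gamma_walk_contract[OF assms, of T], of x]
      unfolding funpow.simps o_apply by linarith
  qed
  show ?thesis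
  proof (induction T arbitrary: x)
    case 0
    \<comment> \<open>Nothing is accumulated at the start: \<open>a = 0\<close>, and
      \<open>M + \<epsilon> * K * M = M * (2 - ?q)\<close>.\<close>
    show ?case
      using step[of 0 M 0 "\<lambda>_. 0" x] assms by (simp add: algebra_simps)
  next
    case (Suc T)
    have "(laplacian (walk (Suc T) g) x)\<^sup>2 \<le> walk_step \<epsilon> (\<lambda>y. (laplacian (walk T g) y)\<^sup>2) x"
      using \<epsilon>_pos \<epsilon>K walk_step_Jensen[of \<epsilon> "laplacian (walk T g)" x]
      by (simp add: laplacian_walk_step)
    then have "2 * \<epsilon> / n * real (Suc T) * (laplacian (walk (Suc T) g) x)\<^sup>2
        \<le> 2 * \<epsilon> / n * real (Suc T) * walk_step \<epsilon> (\<lambda>y. (laplacian (walk T g) y)\<^sup>2) x"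
      using \<epsilon>_pos n_pos by (intro mult_left_mono) auto
    \<comment> \<open>The errors telescope because \<open>\<epsilon> * K = 1 - ?q\<close>.\<close>
    moreover have "M * (2 - ?q ^ Suc T) + \<epsilon> * K * (?q ^ Suc T * M) = M * (2 - ?q ^ Suc (Suc T))"
      by (simp add: algebra_simps)
    moreover have "2 * \<epsilon> / n * real (Suc (Suc T)) * (laplacian (walk (Suc T) g) x)\<^sup>2
      = 2 * \<epsilon> / n * real (Suc T) * (laplacian (walk (Suc T) g) x)\<^sup>2
        + 2 * \<epsilon> / n * (laplacian (walk (Suc T) g) x)\<^sup>2"
      by (simp add: algebra_simps add_divide_distrib)
    ultimately show ?case
      using step[OF Suc.IH, of x] by linarith
  qed
qed

text \<open>Positivity of \<open>Gamma\<close> leaves a bound on the dimension term. The left side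
  is the displacement in step \<open>T + 1\<close> of the walk.\<close>

lemma abs_laplacian_walk_le:
  assumes "\<And>y. Gamma g g y \<le> M"
  shows "\<epsilon> * \<bar>laplacian (walk T g) x\<bar> \<le> sqrt (n * \<epsilon> * M) / sqrt (real (Suc T))"
proof -
  have M: "0 \<le> M" using assms[of x] Gamma_nonneg[of g x] by linarith
  have "0 \<le> (1 - \<epsilon> * K) ^ Suc T"
    using \<epsilon>K by (intro zero_le_power) auto
  then have "M * (2 - (1 - \<epsilon> * K) ^ Suc T) \<le> M * 2"
    using M by (intro mult_left_mono) auto
  then have "2 * \<epsilon> / n * real (Suc T) * (laplacian (walk T g) x)\<^sup>2 \<le> 2 * M"
    using Gamma_walk_plus_laplacian[OF assms, of T x] Gamma_nonneg[of "walk (Suc T) g" x]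
    by linarith
  then have "(laplacian (walk T g) x)\<^sup>2 * (real (Suc T) * \<epsilon>) \<le> M * n"
    using n_pos by (simp add: field_simps)
  then have "\<epsilon> * ((laplacian (walk T g) x)\<^sup>2 * (real (Suc T) * \<epsilon>)) \<le> \<epsilon> * (M * n)"
    using \<epsilon>_pos by (intro mult_left_mono) auto
  then have "(\<epsilon> * \<bar>laplacian (walk T g) x\<bar>)\<^sup>2 \<le> n * \<epsilon> * M / real (Suc T)"
    by (simp add: field_simps power2_eq_square)
  then show ?thesis
    by (simp only: real_le_rsqrt flip: real_sqrt_divide)
qed

text \<open>Sums the displacements, using that the sum of \<open>1 / sqrt k\<close> for k = 1, ...,
  N is at most \<open>2 * sqrt N\<close>.\<close>

lemma abs_walk_diff_le:
  assumes "\<And>y. Gamma g g y \<le> M"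
  shows "\<bar>walk N g x - g x\<bar> \<le> 2 * sqrt (n * \<epsilon> * M) * sqrt (real N)"
proof (induction N)
  case (Suc N)
  have M: "0 \<le> M" using assms[of x] Gamma_nonneg[of g x] by linarith
  have s: "2 * sqrt (real N) + 1 / sqrt (real (Suc N)) \<le> 2 * sqrt (real (Suc N))"
  proof -
    define a b where "a = sqrt (real N)" and "b = sqrt (real (Suc N))"
    have b: "0 < b" "b\<^sup>2 = a\<^sup>2 + 1"
      by (auto simp: a_def b_def)
    \<comment> \<open>With \<open>b\<^sup>2 = a\<^sup>2 + 1\<close> this square is
      \<open>2 * b\<^sup>2 - 1 - 2 * a * b\<close>.\<close>
    have "0 \<le> (b - a)\<^sup>2" by simp
    then have "2 * a * b + 1 \<le> 2 * b * b"
      using b(2) by (simp add: power2_diff) (simp add: power2_eq_square mult_ac)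
    then have "2 * a + 1 / b \<le> 2 * b"
      using b(1) by (simp add: field_simps)
    then show ?thesis by (simp add: a_def b_def)
  qed
  have "walk (Suc N) g x - g x = (walk N g x - g x) + \<epsilon> * laplacian (walk N g) x"
    by (simp add: walk_step_def)
  then have "\<bar>walk (Suc N) g x - g x\<bar> \<le> \<bar>walk N g x - g x\<bar> + \<epsilon> * \<bar>laplacian (walk N g) x\<bar>"
    using \<epsilon>_pos abs_triangle_ineq[of "walk N g x - g x" "\<epsilon> * laplacian (walk N g) x"]
    by (simp add: abs_mult)
  also have "\<dots> \<le> sqrt (n * \<epsilon> * M) * (2 * sqrt (real N) + 1 / sqrt (real (Suc N)))"
    using Suc.IH abs_laplacian_walk_le[OF assms, of N x] by (simp add: algebra_simps)
  also have "\<dots> \<le> sqrt (n * \<epsilon> * M) * (2 * sqrt (real (Suc N)))"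
    using n_pos \<epsilon>_pos M by (intro mult_left_mono s) auto
  finally show ?case by (simp add: mult_ac)
qed simp

section \<open>Blocks of steps and the oscillation bound\<close>

definition block :: nat where
  "block = nat \<lceil>2 / (\<epsilon> * K)\<rceil>"

text \<open>Rounding up adds at most one step, which costs \<epsilon>K < 1.\<close>

lemma block_bounds: "2 \<le> \<epsilon> * K * real block" "\<epsilon> * real block \<le> 3 / K"
proof -
  have "2 / (\<epsilon> * K) \<le> real block" "real block \<le> 2 / (\<epsilon> * K) + 1"
    unfolding block_def using \<epsilon>K by (auto simp: of_nat_ceiling intro: less_imp_le)
  then have "2 \<le> \<epsilon> * K * real block" "\<epsilon> * K * real block \<le> \<epsilon> * K * (2 / (\<epsilon> * K) + 1)"
    using \<epsilon>K(1) by (simp add: field_simps, intro mult_left_mono) auto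
  moreover have "\<epsilon> * K * (2 / (\<epsilon> * K) + 1) = 2 + \<epsilon> * K"
    using \<epsilon>_pos K_pos by (simp add: field_simps)
  ultimately show "2 \<le> \<epsilon> * K * real block" "\<epsilon> * real block \<le> 3 / K"
    using \<epsilon>K(2) K_pos by (simp_all add: field_simps)
qed

text \<open>Uses 1 - s \<le> exp(-s) with total exponent at least 2, and e \<ge> 2.\<close>

lemma block_contract: "(1 - \<epsilon> * K) ^ block \<le> 1 / 4"
proof -
  have "(1 - \<epsilon> * K) ^ block \<le> exp (- (\<epsilon> * K)) ^ block"
    using exp_ge_add_one_self[of "- (\<epsilon> * K)"] \<epsilon>K by (intro power_mono) auto
  also have "\<dots> = exp (- (\<epsilon> * K * real block))"
    by (simp add: exp_of_nat_mult[symmetric] mult.commute)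
  also have "\<dots> \<le> exp (- 2)"
    using block_bounds by simp
  also have "\<dots> = 1 / (exp 1 * exp 1)"
    by (simp add: exp_minus field_simps flip: exp_add)
  also have "\<dots> \<le> 1 / (2 * 2)"
    using exp_ge_add_one_self[of 1] by (intro divide_left_mono mult_mono) auto
  finally show ?thesis by simp
qed

lemma blocks_Gamma:
  assumes "\<And>y. Gamma g g y \<le> M"
  shows "Gamma ((walk block ^^ j) g) ((walk block ^^ j) g) x \<le> (1 / 4) ^ j * M"
proof (induction j arbitrary: x)
  case 0
  then show ?case using assms by simp
next
  case (Suc j)
  have M: "0 \<le> M" using assms[of x] Gamma_nonneg[of g x] by linarith
  have "Gamma ((walk block ^^ Suc j) g) ((walk block ^^ Suc j) g) x
      \<le> (1 - \<epsilon> * K) ^ block * ((1 / 4) ^ j * M)"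
    using Gamma_walk_contract[OF Suc.IH, of block x] by simp
  also have "\<dots> \<le> 1 / 4 * ((1 / 4) ^ j * M)"
    using M by (intro mult_right_mono block_contract) auto
  finally show ?case by simp
qed

text \<open>Block \<open>j + 1\<close> starts from the bound \<open>(1 / 4) ^ j * M\<close>, so it
  moves the function by at most \<open>2 * (1 / 2) ^ j * sqrt (3 * n * M / K)\<close>: a geometric
  series.\<close>

lemma blocks_diff:
  assumes "\<And>y. Gamma g g y \<le> M"
  shows "\<bar>(walk block ^^ j) g x - g x\<bar> \<le> 4 * sqrt (3 * n * M / K) * (1 - (1 / 2) ^ j)"
proof (induction j)
  case (Suc j)
  let ?h = "(walk block ^^ j) g"
  have M: "0 \<le> M" using assms[of x] Gamma_nonneg[of g x] by linarith
  have "\<bar>walk block ?h x - ?h x\<bar> \<le> 2 * sqrt (n * \<epsilon> * ((1 / 4) ^ j * M)) * sqrt (real block)"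
    by (rule abs_walk_diff_le[OF blocks_Gamma[OF assms]])
  also have "\<dots> = 2 * sqrt ((1 / 4) ^ j * (n * M * (\<epsilon> * real block)))"
    by (simp add: mult_ac flip: real_sqrt_mult)
  also have "\<dots> \<le> 2 * sqrt ((1 / 4) ^ j * (n * M * (3 / K)))"
    using block_bounds n_pos M by (intro mult_left_mono real_sqrt_le_mono) auto
  also have "\<dots> = 2 * (1 / 2) ^ j * sqrt (3 * n * M / K)"
    by (simp add: real_sqrt_mult real_sqrt_power real_sqrt_divide mult_ac)
  finally show ?case
    using Suc.IH by (simp add: algebra_simps)
qed simp

lemma oscillation_le_walk:
  assumes "\<And>y. Gamma f f y \<le> M"
  shows "\<bar>f x - f y\<bar> \<le> 8 * sqrt (3 * n * M / K)"
proof -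
  let ?b = "sqrt (3 * n * M / K)"
  have M: "0 \<le> M" using assms[of x] Gamma_nonneg[of f x] by linarith
  then have b: "0 \<le> ?b" using n_pos K_pos by simp
  \<comment> \<open>\<open>C\<close> is fixed before \<open>j\<close>, so the middle term of the
    triangle inequality tends to 0 and each end costs at most \<open>4 * ?b\<close>.\<close>
  obtain C where C: "\<And>h M. (\<forall>z. Gamma h h z \<le> M) \<Longrightarrow> \<bar>h x - h y\<bar> \<le> C * sqrt M"
    using abs_diff_le_sqrt_Gamma[of x y] by blast
  have "\<bar>f x - f y\<bar> \<le> 8 * ?b + C * sqrt ((1 / 4) ^ j * M)" for j
  proof -
    let ?h = "(walk block ^^ j) f"
    have "4 * ?b * (1 - (1 / 2) ^ j) \<le> 4 * ?b * 1"
      using b by (intro mult_left_mono) auto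
    moreover have "\<bar>?h x - ?h y\<bar> \<le> C * sqrt ((1 / 4) ^ j * M)"
      using C blocks_Gamma[OF assms] by blast
    ultimately show ?thesis
      using blocks_diff[OF assms, of j x] blocks_diff[OF assms, of j y] by linarith
  qed
  moreover have "(\<lambda>j. 8 * ?b + C * sqrt ((1 / 4) ^ j * M)) \<longlonglongrightarrow> 8 * ?b + C * sqrt (0 * M)"
    by (intro tendsto_intros LIMSEQ_power_zero) auto
  ultimately show ?thesis
    by (intro LIMSEQ_le_const[where X = "\<lambda>j. 8 * ?b + C * sqrt ((1 / 4) ^ j * M)"]) auto
qed

end

section \<open>Choice of the step size and the two diameters\<close>

context weighted_graph
begin

lemma oscillation_le:
  assumes "CDE' n K" "0 < n" "0 < K" and f: "\<And>y. Gamma f f y \<le> M"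
  shows "\<bar>f x - f y\<bar> \<le> 8 * sqrt (3 * n * M / K)"
proof -
  \<comment> \<open>The two bounds give the two step-size conditions of \<open>CD_walk\<close>; the
    \<open>+ 1\<close> keeps the denominator positive when \<open>D_mu = 0\<close>.\<close>
  define \<epsilon> where "\<epsilon> = min (1 / (D_mu + 2 * K)) (K / (4 * D_mu\<^sup>2 + 1))"
  have D: "0 < D_mu + 2 * K" "0 < 4 * D_mu\<^sup>2 + 1"
    using D_mu_nonneg \<open>0 < K\<close> by (auto simp: add_nonneg_pos)
  have \<epsilon>: "0 < \<epsilon>" "\<epsilon> \<le> 1 / (D_mu + 2 * K)" "\<epsilon> \<le> K / (4 * D_mu\<^sup>2 + 1)"
    using D \<open>0 < K\<close> by (auto simp: \<epsilon>_def)
  interpret CD_walk \<omega> \<mu> n K \<epsilon>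
  proof
    show "\<epsilon> * D_mu + 2 * \<epsilon> * K \<le> 1" "\<epsilon> * (4 * D_mu\<^sup>2) \<le> K"
      using \<epsilon> D by (auto simp: field_simps)
  qed (use assms \<epsilon> CDE'_imp_CD in auto)
  show ?thesis by (rule oscillation_le_walk[OF f])
qed

lemma graph_dist_walk: "(x, y) \<in> adj \<omega> ^^ graph_dist x y"
  unfolding graph_dist_def using connected[of x y] by (auto simp: rtrancl_power intro: LeastI)

lemma graph_dist_Suc: "graph_dist x z \<le> Suc (graph_dist x y)" if "0 < \<omega> y z"
  unfolding graph_dist_def[of x z]
  by (rule Least_le) (use graph_dist_walk[of x y] that in \<open>auto simp: adj_def\<close>)

lemma graph_dist_self: "graph_dist x x = 0"
  unfolding graph_dist_def by (rule Least_equality) auto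

text \<open>The distance from \<open>x\<close> changes by at most 1 along an edge, in either
  direction by symmetry of the weights.\<close>

lemma Gamma_graph_dist_le: "Gamma (\<lambda>y. real (graph_dist x y)) (\<lambda>y. real (graph_dist x y)) z \<le> D_mu / 2"
proof -
  have "(real (graph_dist x y) - real (graph_dist x z))\<^sup>2 \<le> 1" if "0 < \<omega> z y" for y
    using graph_dist_Suc[OF that, of x] graph_dist_Suc[of y z x] that
    by (auto simp: abs_square_le_1 weight_sym[of y z])
  then show ?thesis
    using Gamma_le_of_edge_bound[of 1 z "\<lambda>y. real (graph_dist x y)"] by simp
qed

lemma canonical_diam_le:
  assumes "CDE' n K" "0 < n" "0 < K"
  shows "canonical_diam \<le> ereal (8 * sqrt (3 * n / K))"
  unfolding canonical_diam_def canonical_dist_def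
proof (intro SUP_least Sup_least)
  fix x y d
  assume "d \<in> {ereal \<bar>f x - f y\<bar> | f. bounded (range f) \<and> sup_norm (Gamma f f) \<le> 1}"
  then obtain f where d: "d = ereal \<bar>f x - f y\<bar>" and f: "sup_norm (Gamma f f) \<le> 1"
    by blast
  have "Gamma f f z \<le> 1" for z
  proof -
    have "ereal \<bar>Gamma f f z\<bar> \<le> 1"
      using f unfolding sup_norm_def by (meson SUP_upper UNIV_I order_trans)
    then show ?thesis by simp
  qed
  then show "d \<le> ereal (8 * sqrt (3 * n / K))"
    using oscillation_le[OF assms, of f 1 x y] by (simp add: d)
qed

text \<open>The distance from \<open>x\<close> is compared at \<open>y\<close> and at
  \<open>x\<close> itself, where it is 0, with \<open>M = D_mu / 2\<close>.\<close>

lemma graph_diam_le: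
  assumes "CDE' n K" "0 < n" "0 < K"
  shows "graph_diam \<le> ereal (8 * sqrt (3 * n * (D_mu / 2) / K))"
  unfolding graph_diam_def
proof (intro SUP_least)
  fix x y
  show "ereal (real (graph_dist x y)) \<le> ereal (8 * sqrt (3 * n * (D_mu / 2) / K))"
    using oscillation_le[OF assms Gamma_graph_dist_le, of x x y] by (simp add: graph_dist_self)
qed

end

theorem theorem2p4:
  fixes \<omega> :: "'a \<Rightarrow> 'a \<Rightarrow> real" and \<mu> :: "'a \<Rightarrow> real" and n K :: real
  assumes "weighted_graph \<omega> \<mu>"
    and "n > 0" and "K > 0"
    and "weighted_graph.CDE' \<omega> \<mu> n K"
  shows "weighted_graph.canonical_diam \<omega> \<mu> \<le> ereal (4 * sqrt 3 * pi * sqrt (n / K))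
    \<and> weighted_graph.canonical_diam \<omega> \<mu> < \<infinity>
    \<and> weighted_graph.graph_diam \<omega> < \<infinity>
    \<and> weighted_graph.graph_diam \<omega>
        \<le> ereal (2 * pi * sqrt (6 * weighted_graph.D_mu \<omega> \<mu> * n / K))"
proof -
  interpret weighted_graph \<omega> \<mu> by (fact assms)
  \<comment> \<open>One factor 2 of the 8 is singled out to be replaced by
    \<open>pi\<close>.\<close>
  have "8 * sqrt (3 * n / K) = 4 * 2 * (sqrt 3 * sqrt (n / K))"
    by (simp flip: real_sqrt_mult)
  also have "\<dots> \<le> 4 * pi * (sqrt 3 * sqrt (n / K))"
    using pi_ge_two assms by (intro mult_right_mono mult_left_mono) auto
  finally have "8 * sqrt (3 * n / K) \<le> 4 * sqrt 3 * pi * sqrt (n / K)"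
    by (simp add: mult_ac)
  then have c: "canonical_diam \<le> ereal (4 * sqrt 3 * pi * sqrt (n / K))"
    using canonical_diam_le[OF assms(4,2,3)] by (meson ereal_less_eq(3) order_trans)
  \<comment> \<open>Another factor 2 goes under the root as 4, turning 3/2 into 6.\<close>
  have "8 * sqrt (3 * n * (D_mu / 2) / K) = 2 * 2 * (sqrt (2\<^sup>2) * sqrt (3 * n * (D_mu / 2) / K))"
    by simp
  also have "\<dots> = 2 * 2 * sqrt (6 * D_mu * n / K)"
    unfolding real_sqrt_mult[symmetric] by (simp add: mult_ac)
  also have "\<dots> \<le> 2 * pi * sqrt (6 * D_mu * n / K)"
    using pi_ge_two assms D_mu_nonneg by (intro mult_right_mono mult_left_mono) auto
  finally have g: "graph_diam \<le> ereal (2 * pi * sqrt (6 * D_mu * n / K))"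
    using graph_diam_le[OF assms(4,2,3)] by (meson ereal_less_eq(3) order_trans)
  from c g show ?thesis
    by (auto intro: le_less_trans)
qed

end
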